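(* Let $R$ be an associative ring with unity. Any right $R$-module $M$ that is either Noetherian or Artinian has a decomposition $M=P\oplus N$ into the direct sum of a projective submodule $P$ and a stable submodule $N$. In particular, if $R$ is right Noetherian, then every finitely generated right $R$-module has such a decomposition.
   Context: Modules are unital. A module is called stable if it has no nonzero projective direct summand. *)

theory Defs
  imports "HOL-Algebra.Module" "HOL-Algebra.AbelCoset"
begin

text \<open>
  The library locale \<open>module\<close> asks for a commutative ring of scalars. For right modules over an
  arbitrary ring we keep the library record, whose operation \<open>a \<odot> x\<close> is to be read here as the
  right action \<open>x a\<close>; this is what the reversal of the factors in \<open>smult_assoc\<close> expresses.
  The library locale \<open>submodule\<close> does not depend on commutativity and is used unchanged.
\<close>

locale right_module = R?: ring R + M?: abelian_group M for R (structure) and M (structure) +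
  assumes smult_closed [simp, intro]:
      "\<lbrakk>a \<in> carrier R; x \<in> carrier M\<rbrakk> \<Longrightarrow> a \<odot>\<^bsub>M\<^esub> x \<in> carrier M"
    and smult_distr_scalar:
      "\<lbrakk>a \<in> carrier R; b \<in> carrier R; x \<in> carrier M\<rbrakk> \<Longrightarrow>
        (a \<oplus>\<^bsub>R\<^esub> b) \<odot>\<^bsub>M\<^esub> x = a \<odot>\<^bsub>M\<^esub> x \<oplus>\<^bsub>M\<^esub> b \<odot>\<^bsub>M\<^esub> x"
    and smult_distr_vector:
      "\<lbrakk>a \<in> carrier R; x \<in> carrier M; y \<in> carrier M\<rbrakk> \<Longrightarrow>
        a \<odot>\<^bsub>M\<^esub> (x \<oplus>\<^bsub>M\<^esub> y) = a \<odot>\<^bsub>M\<^esub> x \<oplus>\<^bsub>M\<^esub> a \<odot>\<^bsub>M\<^esub> y"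
    and smult_assoc:
      "\<lbrakk>a \<in> carrier R; b \<in> carrier R; x \<in> carrier M\<rbrakk> \<Longrightarrow>
        (a \<otimes>\<^bsub>R\<^esub> b) \<odot>\<^bsub>M\<^esub> x = b \<odot>\<^bsub>M\<^esub> (a \<odot>\<^bsub>M\<^esub> x)"
    and smult_one [simp]: "x \<in> carrier M \<Longrightarrow> \<one>\<^bsub>R\<^esub> \<odot>\<^bsub>M\<^esub> x = x"

definition regular_right_module :: "('r, 's) ring_scheme \<Rightarrow> ('r, 'r) module" where
  "regular_right_module R =
     \<lparr>carrier = carrier R, mult = mult R, one = one R, zero = zero R, add = add R,
      smult = (\<lambda>a x. x \<otimes>\<^bsub>R\<^esub> a)\<rparr>"

definition right_module_hom ::
    "('r, 's) ring_scheme \<Rightarrow> ('r, 'a, 'm) module_scheme \<Rightarrow> ('r, 'b, 'n) module_scheme \<Rightarrow> ('a \<Rightarrow> 'b) set"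
  where "right_module_hom R A B =
     {f \<in> hom (add_monoid A) (add_monoid B).
        \<forall>a\<in>carrier R. \<forall>x\<in>carrier A. f (a \<odot>\<^bsub>A\<^esub> x) = a \<odot>\<^bsub>B\<^esub> f x}"

definition noetherian_module :: "('r, 's) ring_scheme \<Rightarrow> ('r, 'a, 'm) module_scheme \<Rightarrow> bool" where
  "noetherian_module R M \<longleftrightarrow>
     (\<forall>H::nat \<Rightarrow> 'a set. (\<forall>n. submodule (H n) R M) \<and> (\<forall>n. H n \<subseteq> H (Suc n)) \<longrightarrow>
        (\<exists>n. \<forall>m\<ge>n. H m = H n))"

definition artinian_module :: "('r, 's) ring_scheme \<Rightarrow> ('r, 'a, 'm) module_scheme \<Rightarrow> bool" where
  "artinian_module R M \<longleftrightarrow>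
     (\<forall>H::nat \<Rightarrow> 'a set. (\<forall>n. submodule (H n) R M) \<and> (\<forall>n. H (Suc n) \<subseteq> H n) \<longrightarrow>
        (\<exists>n. \<forall>m\<ge>n. H m = H n))"

definition right_noetherian_ring :: "('r, 's) ring_scheme \<Rightarrow> bool" where
  "right_noetherian_ring R \<longleftrightarrow> ring R \<and> noetherian_module R (regular_right_module R)"

definition finitely_generated_module ::
    "('r, 's) ring_scheme \<Rightarrow> ('r, 'a, 'm) module_scheme \<Rightarrow> bool" where
  "finitely_generated_module R M \<longleftrightarrow>
     (\<exists>S. finite S \<and> S \<subseteq> carrier M \<and> \<Inter>{H. submodule H R M \<and> S \<subseteq> H} = carrier M)"

definition internal_direct_sum ::
    "('r, 's) ring_scheme \<Rightarrow> ('r, 'a, 'm) module_scheme \<Rightarrow> 'a set \<Rightarrow> 'a set \<Rightarrow> bool" where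
  "internal_direct_sum R M P N \<longleftrightarrow>
     submodule P R M \<and> submodule N R M \<and> P <+>\<^bsub>M\<^esub> N = carrier M \<and> P \<inter> N = {\<zero>\<^bsub>M\<^esub>}"

definition has_lifting ::
    "('r, 's) ring_scheme \<Rightarrow> ('r, 'a, 'm) module_scheme \<Rightarrow> ('r, 'b, 'n) module_scheme \<Rightarrow>
     ('r, 'c, 'k) module_scheme \<Rightarrow> bool" where
  "has_lifting R M A B \<longleftrightarrow>
     (\<forall>g\<in>right_module_hom R A B. \<forall>f\<in>right_module_hom R M B. g ` carrier A = carrier B \<longrightarrow>
        (\<exists>h\<in>right_module_hom R M A. \<forall>x\<in>carrier M. g (h x) = f x))"

text \<open>
  Projectivity is the usual lifting property along epimorphisms \<open>A \<rightarrow> B\<close>. A definition cannot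
  quantify over types, so the test modules have carriers in fixed types. These types are large
  enough: the free module on the underlying set of \<open>M\<close> lives on a subset of \<open>'a \<Rightarrow> 'r\<close>, and
  \<open>projective_has_lifting\<close> below derives the lifting property for test modules over arbitrary types.
\<close>

definition projective_module ::
    "('r, 's) ring_scheme \<Rightarrow> ('r, 'a, 'm) module_scheme \<Rightarrow> bool" where
  "projective_module R M \<longleftrightarrow> right_module R M \<and>
     (\<forall>(A :: ('r, 'a \<Rightarrow> 'r) module) (B :: ('r, 'a) module).
        right_module R A \<and> right_module R B \<longrightarrow> has_lifting R M A B)"

definition stable_module :: "('r, 's) ring_scheme \<Rightarrow> ('r, 'a, 'm) module_scheme \<Rightarrow> bool" where
  "stable_module R M \<longleftrightarrow>
     (\<forall>P Q. internal_direct_sum R M P Q \<and> projective_module R (M\<lparr>carrier := P\<rparr>) \<longrightarrow>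
        P = {\<zero>\<^bsub>M\<^esub>})"


subsection \<open>Independence of projectivity from the types of the test modules\<close>

definition free_right_module :: "('r, 's) ring_scheme \<Rightarrow> 'x set \<Rightarrow> ('r, 'x \<Rightarrow> 'r) module" where
  "free_right_module R X =
     \<lparr>carrier = {p. (\<forall>x. p x \<in> carrier R) \<and> (\<forall>x. x \<notin> X \<longrightarrow> p x = \<zero>\<^bsub>R\<^esub>) \<and> finite {x. p x \<noteq> \<zero>\<^bsub>R\<^esub>}},
      mult = undefined, one = undefined, zero = (\<lambda>_. \<zero>\<^bsub>R\<^esub>), add = (\<lambda>p q x. p x \<oplus>\<^bsub>R\<^esub> q x),
      smult = (\<lambda>a p x. p x \<otimes>\<^bsub>R\<^esub> a)\<rparr>"

definition free_extension ::
    "('r, 's) ring_scheme \<Rightarrow> ('r, 'b, 'n) module_scheme \<Rightarrow> ('x \<Rightarrow> 'b) \<Rightarrow> ('x \<Rightarrow> 'r) \<Rightarrow> 'b" where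
  "free_extension R A u p = (\<Oplus>\<^bsub>A\<^esub>x\<in>{x. p x \<noteq> \<zero>\<^bsub>R\<^esub>}. p x \<odot>\<^bsub>A\<^esub> u x)"

context right_module
begin

lemma smult_scalar_zero [simp]:
  assumes "x \<in> carrier M" shows "\<zero>\<^bsub>R\<^esub> \<odot>\<^bsub>M\<^esub> x = \<zero>\<^bsub>M\<^esub>"
proof -
  have "\<zero>\<^bsub>R\<^esub> \<odot>\<^bsub>M\<^esub> x \<oplus>\<^bsub>M\<^esub> \<zero>\<^bsub>R\<^esub> \<odot>\<^bsub>M\<^esub> x = \<zero>\<^bsub>R\<^esub> \<odot>\<^bsub>M\<^esub> x"
    using smult_distr_scalar[of "\<zero>\<^bsub>R\<^esub>" "\<zero>\<^bsub>R\<^esub>" x] assms by simp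
  then show ?thesis using assms M.add.l_cancel_one by blast
qed

lemma smult_vector_zero [simp]:
  assumes "a \<in> carrier R" shows "a \<odot>\<^bsub>M\<^esub> \<zero>\<^bsub>M\<^esub> = \<zero>\<^bsub>M\<^esub>"
proof -
  have "a \<odot>\<^bsub>M\<^esub> \<zero>\<^bsub>M\<^esub> \<oplus>\<^bsub>M\<^esub> a \<odot>\<^bsub>M\<^esub> \<zero>\<^bsub>M\<^esub> = a \<odot>\<^bsub>M\<^esub> \<zero>\<^bsub>M\<^esub>"
    using smult_distr_vector[of a "\<zero>\<^bsub>M\<^esub>" "\<zero>\<^bsub>M\<^esub>"] assms by simp
  then show ?thesis using assms M.add.l_cancel_one by blast
qed

lemma smult_finsum:
  assumes "finite I" "a \<in> carrier R" "f \<in> I \<rightarrow> carrier M"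
  shows "a \<odot>\<^bsub>M\<^esub> (\<Oplus>\<^bsub>M\<^esub>i\<in>I. f i) = (\<Oplus>\<^bsub>M\<^esub>i\<in>I. a \<odot>\<^bsub>M\<^esub> f i)"
  using assms
  by (induction I rule: finite_induct) (auto simp: Pi_def smult_distr_vector)

lemma free_extension_superset:
  assumes "finite J" "{x. p x \<noteq> \<zero>\<^bsub>R\<^esub>} \<subseteq> J" "\<And>x. p x \<in> carrier R" "u \<in> J \<rightarrow> carrier M"
  shows "free_extension R M u p = (\<Oplus>\<^bsub>M\<^esub>x\<in>J. p x \<odot>\<^bsub>M\<^esub> u x)"
  unfolding free_extension_def
  by (rule M.add.finprod_mono_neutral_cong_left) (use assms in \<open>auto simp: Pi_def\<close>)

lemma free_extension_hom:
  assumes u: "u \<in> X \<rightarrow> carrier M"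
  shows "free_extension R M u \<in> right_module_hom R (free_right_module R X) M"
proof -
  let ?F = "free_right_module R X"
  have sub: "{x. p x \<noteq> \<zero>\<^bsub>R\<^esub>} \<subseteq> X" "\<And>x. p x \<in> carrier R" "finite {x. p x \<noteq> \<zero>\<^bsub>R\<^esub>}"
    if "p \<in> carrier ?F" for p
    using that by (auto simp: free_right_module_def)
  have clo: "free_extension R M u p \<in> carrier M" if "p \<in> carrier ?F" for p
    unfolding free_extension_def using sub[OF that] u by (intro M.finsum_closed) (auto simp: Pi_def)
  have add: "free_extension R M u (p \<oplus>\<^bsub>?F\<^esub> q) = free_extension R M u p \<oplus>\<^bsub>M\<^esub> free_extension R M u q"
    if p: "p \<in> carrier ?F" and q: "q \<in> carrier ?F" for p q
  proof -
    let ?J = "{x. p x \<noteq> \<zero>\<^bsub>R\<^esub>} \<union> {x. q x \<noteq> \<zero>\<^bsub>R\<^esub>}"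
    have J: "finite ?J" "u \<in> ?J \<rightarrow> carrier M" using sub[OF p] sub[OF q] u by auto
    have pq: "(p \<oplus>\<^bsub>?F\<^esub> q) = (\<lambda>x. p x \<oplus>\<^bsub>R\<^esub> q x)" by (simp add: free_right_module_def)
    have "free_extension R M u (p \<oplus>\<^bsub>?F\<^esub> q) = (\<Oplus>\<^bsub>M\<^esub>x\<in>?J. (p x \<oplus>\<^bsub>R\<^esub> q x) \<odot>\<^bsub>M\<^esub> u x)"
      unfolding pq using J sub(2)[OF p] sub(2)[OF q] by (intro free_extension_superset) auto
    also have "\<dots> = (\<Oplus>\<^bsub>M\<^esub>x\<in>?J. p x \<odot>\<^bsub>M\<^esub> u x \<oplus>\<^bsub>M\<^esub> q x \<odot>\<^bsub>M\<^esub> u x)"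
      using J sub(2)[OF p] sub(2)[OF q]
      by (intro M.finsum_cong') (auto simp: Pi_def smult_distr_scalar)
    also have "\<dots> = (\<Oplus>\<^bsub>M\<^esub>x\<in>?J. p x \<odot>\<^bsub>M\<^esub> u x) \<oplus>\<^bsub>M\<^esub> (\<Oplus>\<^bsub>M\<^esub>x\<in>?J. q x \<odot>\<^bsub>M\<^esub> u x)"
      using J sub(2)[OF p] sub(2)[OF q] by (intro M.finsum_addf) (auto simp: Pi_def)
    also have "(\<Oplus>\<^bsub>M\<^esub>x\<in>?J. p x \<odot>\<^bsub>M\<^esub> u x) = free_extension R M u p"
      using J sub(2)[OF p] by (intro free_extension_superset[symmetric]) auto
    also have "(\<Oplus>\<^bsub>M\<^esub>x\<in>?J. q x \<odot>\<^bsub>M\<^esub> u x) = free_extension R M u q"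
      using J sub(2)[OF q] by (intro free_extension_superset[symmetric]) auto
    finally show ?thesis .
  qed
  have sm: "free_extension R M u (a \<odot>\<^bsub>?F\<^esub> p) = a \<odot>\<^bsub>M\<^esub> free_extension R M u p"
    if a: "a \<in> carrier R" and p: "p \<in> carrier ?F" for a p
  proof -
    let ?J = "{x. p x \<noteq> \<zero>\<^bsub>R\<^esub>}"
    have J: "finite ?J" "u \<in> ?J \<rightarrow> carrier M" using sub[OF p] u by auto
    have ap: "(a \<odot>\<^bsub>?F\<^esub> p) = (\<lambda>x. p x \<otimes>\<^bsub>R\<^esub> a)" by (simp add: free_right_module_def)
    have "free_extension R M u (a \<odot>\<^bsub>?F\<^esub> p) = (\<Oplus>\<^bsub>M\<^esub>x\<in>?J. (p x \<otimes>\<^bsub>R\<^esub> a) \<odot>\<^bsub>M\<^esub> u x)"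
      unfolding ap using J a sub(2)[OF p] by (intro free_extension_superset) auto
    also have "\<dots> = (\<Oplus>\<^bsub>M\<^esub>x\<in>?J. a \<odot>\<^bsub>M\<^esub> (p x \<odot>\<^bsub>M\<^esub> u x))"
      using J a sub(2)[OF p] by (intro M.finsum_cong') (auto simp: Pi_def smult_assoc)
    also have "\<dots> = a \<odot>\<^bsub>M\<^esub> free_extension R M u p"
      unfolding free_extension_def
      using J a sub(2)[OF p] by (intro smult_finsum[symmetric]) (auto simp: Pi_def)
    finally show ?thesis .
  qed
  show ?thesis
    using clo add sm by (auto simp: right_module_hom_def hom_def)
qed

end

lemma (in ring) free_right_module_is_right_module: "right_module R (free_right_module R X)"
proof -
  let ?F = "free_right_module R X"
  have fin_add: "finite {x. p x \<oplus> q x \<noteq> \<zero>}"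
    if "finite {x. p x \<noteq> \<zero>}" "finite {x. q x \<noteq> \<zero>}" for p q :: "'c \<Rightarrow> 'a"
    by (rule finite_subset[OF _ finite_UnI[OF that]]) auto
  have fin_mult: "finite {x. p x \<otimes> a \<noteq> \<zero>}"
    if "finite {x. p x \<noteq> \<zero>}" "a \<in> carrier R" for p :: "'c \<Rightarrow> 'a" and a
    by (rule finite_subset[OF _ that(1)]) (use that(2) in auto)
  have fin_inv: "finite {x. \<ominus> p x \<noteq> \<zero>}" if "finite {x. p x \<noteq> \<zero>}" for p :: "'c \<Rightarrow> 'a"
    by (rule finite_subset[OF _ that]) auto
  have "abelian_group ?F"
  proof (rule abelian_groupI)
    fix p assume p: "p \<in> carrier ?F"
    show "\<exists>q\<in>carrier ?F. q \<oplus>\<^bsub>?F\<^esub> p = \<zero>\<^bsub>?F\<^esub>"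
      using p by (intro bexI[of _ "\<lambda>x. \<ominus> p x"])
        (auto simp: free_right_module_def l_neg fin_inv)
  qed (auto simp: free_right_module_def a_ac fin_add)
  then show ?thesis
    by (intro right_module.intro right_module_axioms.intro ring_axioms)
      (auto simp: free_right_module_def fin_mult l_distr r_distr m_assoc)
qed

lemma right_module_hom_free_extension:
  assumes A: "right_module R A" and B: "right_module R B"
    and g: "g \<in> right_module_hom R A B" and u: "u \<in> X \<rightarrow> carrier A"
    and p: "p \<in> carrier (free_right_module R X)"
  shows "g (free_extension R A u p) = free_extension R B (\<lambda>x. g (u x)) p"
proof -
  interpret A: right_module R A by (rule A)
  interpret B: right_module R B by (rule B)
  have gc: "\<And>x. x \<in> carrier A \<Longrightarrow> g x \<in> carrier B"
    and ga: "\<And>x y. x \<in> carrier A \<Longrightarrow> y \<in> carrier A \<Longrightarrow> g (x \<oplus>\<^bsub>A\<^esub> y) = g x \<oplus>\<^bsub>B\<^esub> g y"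
    and gs: "\<And>a x. a \<in> carrier R \<Longrightarrow> x \<in> carrier A \<Longrightarrow> g (a \<odot>\<^bsub>A\<^esub> x) = a \<odot>\<^bsub>B\<^esub> g x"
    using g by (auto simp: right_module_hom_def hom_def)
  have g0: "g \<zero>\<^bsub>A\<^esub> = \<zero>\<^bsub>B\<^esub>"
    using gs[of "\<zero>\<^bsub>R\<^esub>" "\<zero>\<^bsub>A\<^esub>"] gc[of "\<zero>\<^bsub>A\<^esub>"] by simp
  have pX: "finite {x. p x \<noteq> \<zero>\<^bsub>R\<^esub>}" "{x. p x \<noteq> \<zero>\<^bsub>R\<^esub>} \<subseteq> X" "\<And>x. p x \<in> carrier R"
    using p by (auto simp: free_right_module_def)
  have "g (\<Oplus>\<^bsub>A\<^esub>x\<in>I. p x \<odot>\<^bsub>A\<^esub> u x) = (\<Oplus>\<^bsub>B\<^esub>x\<in>I. p x \<odot>\<^bsub>B\<^esub> g (u x))"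
    if "finite I" "I \<subseteq> X" for I
    using that
  proof (induction I rule: finite_induct)
    case (insert i I)
    have uI: "u x \<in> carrier A" if "x \<in> insert i I" for x using insert.prems that u by auto
    show ?case using insert uI pX(3)
      by (auto simp: Pi_def ga gs gc)
  qed (simp add: g0)
  then show ?thesis using pX by (simp add: free_extension_def)
qed

theorem projective_has_lifting:
  fixes M :: "('r, 'a, 'm) module_scheme"
    and A :: "('r, 'b, 'n) module_scheme" and B :: "('r, 'c, 'k) module_scheme"
  assumes M: "projective_module R M" and A: "right_module R A" and B: "right_module R B"
  shows "has_lifting R M A B"
  unfolding has_lifting_def
proof (intro ballI impI)
  fix g f
  assume g: "g \<in> right_module_hom R A B" and f: "f \<in> right_module_hom R M B"
    and surj: "g ` carrier A = carrier B"
  interpret M: right_module R M using M by (simp add: projective_module_def)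
  interpret A: right_module R A by (rule A)
  define F where "F = free_right_module R (carrier M)"
  define M' :: "('r, 'a) module" where "M' = module.truncate M"
  have M'_simps [simp]: "carrier M' = carrier M" "add M' = add M" "zero M' = zero M"
      "smult M' = smult M"
    by (simp_all add: M'_def module.truncate_def)
  have "right_module R M'"
  proof (intro right_module.intro right_module_axioms.intro M.R.ring_axioms)
    show "abelian_group M'"
    proof (rule abelian_groupI)
      show "\<exists>y\<in>carrier M'. y \<oplus>\<^bsub>M'\<^esub> x = \<zero>\<^bsub>M'\<^esub>" if "x \<in> carrier M'" for x
        using that M.M.l_neg[of x] by (intro bexI[of _ "\<ominus>\<^bsub>M\<^esub> x"]) auto
    qed (auto intro: M.M.a_assoc M.M.a_comm)
  qed (auto simp: M.smult_distr_scalar M.smult_distr_vector M.smult_assoc)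
  moreover have "right_module R F"
    unfolding F_def by (rule M.R.free_right_module_is_right_module)
  ultimately have lift: "has_lifting R M F M'"
    using M by (auto simp: projective_module_def)
  define e where "e = free_extension R M (\<lambda>x. x)"
  have e: "e \<in> right_module_hom R F M"
    unfolding e_def F_def by (rule M.free_extension_hom) auto
  then have e': "e \<in> right_module_hom R F M'"
    by (auto simp: right_module_hom_def hom_def)
  have "e ` carrier F = carrier M'"
  proof
    show "e ` carrier F \<subseteq> carrier M'" using e' by (auto simp: right_module_hom_def hom_def)
    show "carrier M' \<subseteq> e ` carrier F"
    proof
      fix x assume "x \<in> carrier M'"
      then have x: "x \<in> carrier M" by simp
      define p where "p = (\<lambda>y. if y = x then \<one>\<^bsub>R\<^esub> else \<zero>\<^bsub>R\<^esub>)"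
      have fin: "finite {y. p y \<noteq> \<zero>\<^bsub>R\<^esub>}"
        by (rule finite_subset[of _ "{x}"]) (auto simp: p_def)
      have "p \<in> carrier F" using x fin by (auto simp: F_def free_right_module_def p_def)
      moreover have "e p = (\<Oplus>\<^bsub>M\<^esub>y\<in>{x}. p y \<odot>\<^bsub>M\<^esub> y)"
        unfolding e_def by (rule M.free_extension_superset) (use x in \<open>auto simp: p_def\<close>)
      then have "e p = x" using x by (simp add: p_def)
      ultimately show "x \<in> e ` carrier F" by force
    qed
  qed
  moreover have "(\<lambda>x. x) \<in> right_module_hom R M M'"
    by (auto simp: right_module_hom_def hom_def)
  ultimately have "\<exists>s\<in>right_module_hom R M F. \<forall>x\<in>carrier M. e (s x) = x"
    using lift[unfolded has_lifting_def, rule_format, OF e', of "\<lambda>x. x"] by blast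
  then obtain s where s: "s \<in> right_module_hom R M F"
    and es: "\<And>x. x \<in> carrier M \<Longrightarrow> e (s x) = x"
    by blast
  have "\<forall>x\<in>carrier M. \<exists>a\<in>carrier A. g a = f x"
  proof
    fix x assume "x \<in> carrier M"
    then have "f x \<in> g ` carrier A" using f unfolding surj by (auto simp: right_module_hom_def hom_def)
    then show "\<exists>a\<in>carrier A. g a = f x" by auto
  qed
  then obtain u where u: "u \<in> carrier M \<rightarrow> carrier A"
    and gu: "\<And>x. x \<in> carrier M \<Longrightarrow> g (u x) = f x" by (metis Pi_I')
  have hA: "free_extension R A u \<in> right_module_hom R F A"
    unfolding F_def by (rule A.free_extension_hom[OF u])
  show "\<exists>h\<in>right_module_hom R M A. \<forall>x\<in>carrier M. g (h x) = f x"
  proof (intro bexI[of _ "\<lambda>x. free_extension R A u (s x)"] ballI)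
    show "(\<lambda>x. free_extension R A u (s x)) \<in> right_module_hom R M A"
      using hA s by (auto simp: right_module_hom_def hom_def Pi_def)
    fix x assume x: "x \<in> carrier M"
    have sx: "s x \<in> carrier (free_right_module R (carrier M))"
      using s x by (auto simp: right_module_hom_def hom_def F_def)
    have "g (free_extension R A u (s x)) = free_extension R B (\<lambda>y. g (u y)) (s x)"
      by (rule right_module_hom_free_extension[OF A B g u sx])
    also have "\<dots> = free_extension R B (\<lambda>y. f y) (s x)"
    proof -
      interpret B: right_module R B by (rule B)
      have "f \<in> carrier M \<rightarrow> carrier B" using f by (auto simp: right_module_hom_def hom_def)
      moreover have "y \<in> carrier M" if "s x y \<noteq> \<zero>\<^bsub>R\<^esub>" for y
        using sx that by (auto simp: free_right_module_def)
      moreover have "s x y \<in> carrier R" for y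
        using sx by (auto simp: free_right_module_def)
      ultimately show ?thesis
        unfolding free_extension_def using gu by (intro B.finsum_cong') auto
    qed
    also have "\<dots> = f (e (s x))"
      unfolding e_def
      using right_module_hom_free_extension[OF M.right_module_axioms B f, of "\<lambda>x. x" "carrier M", OF _ sx]
      by simp
    finally show "g (free_extension R A u (s x)) = f x" using es[OF x] by simp
  qed
qed

end

theory Submission
  imports Defs
begin

text \<open>
  Call a decomposition \<open>M = P \<oplus> N\<close> with \<open>P\<close> projective a projective splitting. There is always the
  trivial one with \<open>P = 0\<close>. If the complement \<open>N\<close> of a projective splitting is not stable, then
  \<open>N = P' \<oplus> N'\<close> with \<open>P'\<close> nonzero and projective; since a direct sum of two projective modules is
  projective (\<open>projective_set_add\<close>), \<open>M = (P \<oplus> P') \<oplus> N'\<close> is again a projective splitting, whose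
  projective part is strictly larger and whose complement is strictly smaller
  (\<open>projective_splitting_refine\<close>). If no projective splitting had a stable complement, this could
  be repeated forever: the projective parts would form a strictly ascending chain of submodules
  of \<open>M\<close> and the complements a strictly descending one. The first is impossible in a Noetherian
  module, the second in an Artinian module.

  The claim on finitely generated modules follows because these are Noetherian over a right
  Noetherian ring: adding one generator \<open>s\<close> to a Noetherian submodule \<open>K\<close> keeps it Noetherian,
  since a submodule \<open>H\<close> of \<open>K + sR\<close> is controlled by the submodule \<open>H \<inter> K\<close> of \<open>K\<close> together with
  the right ideal of those scalars \<open>a\<close> for which \<open>s a\<close> lies in \<open>H\<close> up to an element of \<open>K\<close>
  (\<open>noetherian_add_cyclic\<close>).
\<close>

section \<open>Submodules of right modules\<close>

context right_module
begin

lemma smult_minus_one: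
  assumes "x \<in> carrier M"
  shows "(\<ominus>\<^bsub>R\<^esub> \<one>\<^bsub>R\<^esub>) \<odot>\<^bsub>M\<^esub> x = \<ominus>\<^bsub>M\<^esub> x"
proof -
  have "(\<ominus>\<^bsub>R\<^esub> \<one>\<^bsub>R\<^esub>) \<odot>\<^bsub>M\<^esub> x \<oplus>\<^bsub>M\<^esub> x = (\<ominus>\<^bsub>R\<^esub> \<one>\<^bsub>R\<^esub> \<oplus>\<^bsub>R\<^esub> \<one>\<^bsub>R\<^esub>) \<odot>\<^bsub>M\<^esub> x"
    using assms smult_distr_scalar[of "\<ominus>\<^bsub>R\<^esub> \<one>\<^bsub>R\<^esub>" "\<one>\<^bsub>R\<^esub>" x] by simp
  also have "\<dots> = \<zero>\<^bsub>M\<^esub>"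
    using assms by (simp add: R.l_neg)
  finally show ?thesis
    using assms by (intro M.minus_equality[symmetric]) auto
qed

text \<open>
  Closure under negation comes for free, as \<open>- x\<close> is \<open>x\<close> times the scalar \<open>- 1\<close>. In this form the
  notion mentions only data that restricting the carrier of \<open>M\<close> leaves untouched, whereas the
  additive inverse of a restricted module is a different term.
\<close>

lemma submodule_iff:
  "submodule H R M \<longleftrightarrow> H \<subseteq> carrier M \<and> \<zero>\<^bsub>M\<^esub> \<in> H \<and> (\<forall>x\<in>H. \<forall>y\<in>H. x \<oplus>\<^bsub>M\<^esub> y \<in> H) \<and>
     (\<forall>a\<in>carrier R. \<forall>x\<in>H. a \<odot>\<^bsub>M\<^esub> x \<in> H)" (is "?L \<longleftrightarrow> ?R")
proof
  assume ?L
  then interpret H: submodule H R M .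
  show ?R
    using H.subset H.m_closed H.one_closed by auto
next
  assume r: ?R
  have "\<ominus>\<^bsub>M\<^esub> x \<in> H" if "x \<in> H" for x
  proof -
    have "(\<ominus>\<^bsub>R\<^esub> \<one>\<^bsub>R\<^esub>) \<odot>\<^bsub>M\<^esub> x \<in> H" using r that by auto
    then show ?thesis using r that smult_minus_one by (metis subsetD)
  qed
  with r show ?L
    by (intro submodule.intro subgroup.intro submodule_axioms.intro) (auto simp: a_inv_def)
qed

lemma submodule_minus_closed:
  assumes "submodule H R M" "x \<in> H"
  shows "\<ominus>\<^bsub>M\<^esub> x \<in> H"
proof -
  have "(\<ominus>\<^bsub>R\<^esub> \<one>\<^bsub>R\<^esub>) \<odot>\<^bsub>M\<^esub> x \<in> H" "x \<in> carrier M"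
    using assms unfolding submodule_iff by auto
  then show ?thesis by (simp add: smult_minus_one)
qed

lemma right_module_submodule:
  assumes "submodule H R M"
  shows "right_module R (M\<lparr>carrier := H\<rparr>)"
proof -
  have H: "H \<subseteq> carrier M" "\<zero>\<^bsub>M\<^esub> \<in> H" "\<And>x y. x \<in> H \<Longrightarrow> y \<in> H \<Longrightarrow> x \<oplus>\<^bsub>M\<^esub> y \<in> H"
    "\<And>a x. a \<in> carrier R \<Longrightarrow> x \<in> H \<Longrightarrow> a \<odot>\<^bsub>M\<^esub> x \<in> H"
    using assms unfolding submodule_iff by auto
  have "abelian_group (M\<lparr>carrier := H\<rparr>)"
  proof (rule abelian_groupI)
    show "\<exists>y\<in>carrier (M\<lparr>carrier := H\<rparr>). y \<oplus>\<^bsub>M\<lparr>carrier := H\<rparr>\<^esub> x = \<zero>\<^bsub>M\<lparr>carrier := H\<rparr>\<^esub>"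
      if "x \<in> carrier (M\<lparr>carrier := H\<rparr>)" for x
      using that H submodule_minus_closed[OF assms, of x]
      by (intro bexI[of _ "\<ominus>\<^bsub>M\<^esub> x"]) (auto simp: M.l_neg subset_iff)
  qed (use H in \<open>auto simp: subset_iff M.a_ac\<close>)
  then show ?thesis
    using H
    by (intro right_module.intro right_module_axioms.intro R.ring_axioms)
      (auto simp: subset_iff smult_distr_scalar smult_distr_vector smult_assoc)
qed

lemma submodule_of_submodule_iff:
  assumes "submodule K R M"
  shows "submodule H R (M\<lparr>carrier := K\<rparr>) \<longleftrightarrow> submodule H R M \<and> H \<subseteq> K"
  using assms
  unfolding right_module.submodule_iff[OF right_module_submodule[OF assms]] submodule_iff
  by auto

lemma submodule_zero: "submodule {\<zero>\<^bsub>M\<^esub>} R M"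
  unfolding submodule_iff by auto

lemma submodule_carrier: "submodule (carrier M) R M"
  unfolding submodule_iff by auto

lemma submodule_inter:
  assumes "submodule H R M" "submodule K R M"
  shows "submodule (H \<inter> K) R M"
  using assms unfolding submodule_iff by auto

lemma submodule_cyclic:
  assumes "s \<in> carrier M"
  shows "submodule ((\<lambda>a. a \<odot>\<^bsub>M\<^esub> s) ` carrier R) R M"
  unfolding submodule_iff
proof (intro conjI ballI)
  show "\<zero>\<^bsub>M\<^esub> \<in> (\<lambda>a. a \<odot>\<^bsub>M\<^esub> s) ` carrier R"
    using assms by (intro image_eqI[of _ _ "\<zero>\<^bsub>R\<^esub>"]) auto
qed (use assms in \<open>auto simp flip: smult_distr_scalar smult_assoc\<close>)

end

lemma mem_set_add_iff: "x \<in> H <+>\<^bsub>M\<^esub> K \<longleftrightarrow> (\<exists>h\<in>H. \<exists>k\<in>K. x = h \<oplus>\<^bsub>M\<^esub> k)"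
  by (auto simp: set_add_def')

context right_module
begin

lemma submodule_set_add:
  assumes "submodule H R M" "submodule K R M"
  shows "submodule (H <+>\<^bsub>M\<^esub> K) R M" "H \<subseteq> H <+>\<^bsub>M\<^esub> K" "K \<subseteq> H <+>\<^bsub>M\<^esub> K"
proof -
  have H: "H \<subseteq> carrier M" "\<zero>\<^bsub>M\<^esub> \<in> H" "\<And>x y. x \<in> H \<Longrightarrow> y \<in> H \<Longrightarrow> x \<oplus>\<^bsub>M\<^esub> y \<in> H"
    "\<And>a x. a \<in> carrier R \<Longrightarrow> x \<in> H \<Longrightarrow> a \<odot>\<^bsub>M\<^esub> x \<in> H"
    using assms(1) unfolding submodule_iff by auto
  have K: "K \<subseteq> carrier M" "\<zero>\<^bsub>M\<^esub> \<in> K" "\<And>x y. x \<in> K \<Longrightarrow> y \<in> K \<Longrightarrow> x \<oplus>\<^bsub>M\<^esub> y \<in> K"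
    "\<And>a x. a \<in> carrier R \<Longrightarrow> x \<in> K \<Longrightarrow> a \<odot>\<^bsub>M\<^esub> x \<in> K"
    using assms(2) unfolding submodule_iff by auto
  show HS: "H \<subseteq> H <+>\<^bsub>M\<^esub> K"
  proof
    fix x assume "x \<in> H"
    then show "x \<in> H <+>\<^bsub>M\<^esub> K"
      unfolding mem_set_add_iff using H K by (intro bexI[of _ x] bexI[of _ "\<zero>\<^bsub>M\<^esub>"]) auto
  qed
  show "K \<subseteq> H <+>\<^bsub>M\<^esub> K"
  proof
    fix x assume "x \<in> K"
    then show "x \<in> H <+>\<^bsub>M\<^esub> K"
      unfolding mem_set_add_iff using H K by (intro bexI[of _ x] bexI[of _ "\<zero>\<^bsub>M\<^esub>"]) auto
  qed
  show "submodule (H <+>\<^bsub>M\<^esub> K) R M"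
    unfolding submodule_iff
  proof (intro conjI ballI)
    show "H <+>\<^bsub>M\<^esub> K \<subseteq> carrier M"
      using H(1) K(1) by (auto simp: mem_set_add_iff subset_iff)
    show "\<zero>\<^bsub>M\<^esub> \<in> H <+>\<^bsub>M\<^esub> K"
      using HS H by auto
  next
    fix x y assume "x \<in> H <+>\<^bsub>M\<^esub> K" "y \<in> H <+>\<^bsub>M\<^esub> K"
    then obtain h k h' k' where e: "h \<in> H" "k \<in> K" "h' \<in> H" "k' \<in> K"
      "x = h \<oplus>\<^bsub>M\<^esub> k" "y = h' \<oplus>\<^bsub>M\<^esub> k'"
      unfolding mem_set_add_iff by blast
    then have "x \<oplus>\<^bsub>M\<^esub> y = (h \<oplus>\<^bsub>M\<^esub> h') \<oplus>\<^bsub>M\<^esub> (k \<oplus>\<^bsub>M\<^esub> k')"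
      using H K by (simp add: subset_iff M.a_ac)
    then show "x \<oplus>\<^bsub>M\<^esub> y \<in> H <+>\<^bsub>M\<^esub> K"
      unfolding mem_set_add_iff using H(3) K(3) e by blast
  next
    fix a x assume a: "a \<in> carrier R" and "x \<in> H <+>\<^bsub>M\<^esub> K"
    then obtain h k where e: "h \<in> H" "k \<in> K" "x = h \<oplus>\<^bsub>M\<^esub> k"
      unfolding mem_set_add_iff by blast
    then have "a \<odot>\<^bsub>M\<^esub> x = a \<odot>\<^bsub>M\<^esub> h \<oplus>\<^bsub>M\<^esub> a \<odot>\<^bsub>M\<^esub> k"
      using H K a by (simp add: subset_iff smult_distr_vector)
    then show "a \<odot>\<^bsub>M\<^esub> x \<in> H <+>\<^bsub>M\<^esub> K"
      unfolding mem_set_add_iff using H(4) K(4) e a by blast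
  qed
qed

lemma add_unique_if_disjoint:
  assumes "submodule H R M" "submodule K R M" "H \<inter> K = {\<zero>\<^bsub>M\<^esub>}"
    and "h \<in> H" "h' \<in> H" "k \<in> K" "k' \<in> K" "h \<oplus>\<^bsub>M\<^esub> k = h' \<oplus>\<^bsub>M\<^esub> k'"
  shows "h = h'" "k = k'"
proof -
  have c: "h \<in> carrier M" "h' \<in> carrier M" "k \<in> carrier M" "k' \<in> carrier M"
    using assms unfolding submodule_iff by auto
  have "h \<oplus>\<^bsub>M\<^esub> \<ominus>\<^bsub>M\<^esub> h' = (h \<oplus>\<^bsub>M\<^esub> k) \<oplus>\<^bsub>M\<^esub> \<ominus>\<^bsub>M\<^esub> k \<oplus>\<^bsub>M\<^esub> \<ominus>\<^bsub>M\<^esub> h'"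
    using c by (simp add: M.a_assoc M.r_neg)
  also have "\<dots> = (h' \<oplus>\<^bsub>M\<^esub> \<ominus>\<^bsub>M\<^esub> h') \<oplus>\<^bsub>M\<^esub> (k' \<oplus>\<^bsub>M\<^esub> \<ominus>\<^bsub>M\<^esub> k)"
    unfolding assms(8) using c by (simp add: M.a_ac)
  also have "\<dots> = k' \<oplus>\<^bsub>M\<^esub> \<ominus>\<^bsub>M\<^esub> k"
    using c by (simp add: M.r_neg)
  finally have eq: "h \<oplus>\<^bsub>M\<^esub> \<ominus>\<^bsub>M\<^esub> h' = k' \<oplus>\<^bsub>M\<^esub> \<ominus>\<^bsub>M\<^esub> k" .
  have "h \<oplus>\<^bsub>M\<^esub> \<ominus>\<^bsub>M\<^esub> h' \<in> H" "k' \<oplus>\<^bsub>M\<^esub> \<ominus>\<^bsub>M\<^esub> k \<in> K"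
    using assms submodule_minus_closed[OF assms(1), of h'] submodule_minus_closed[OF assms(2), of k]
    unfolding submodule_iff by auto
  with eq assms(3) have "h \<oplus>\<^bsub>M\<^esub> \<ominus>\<^bsub>M\<^esub> h' = \<zero>\<^bsub>M\<^esub>"
    by auto
  then show h: "h = h'"
    using c by (metis M.a_inv_closed M.minus_equality M.minus_minus)
  show "k = k'"
    using assms(8) c unfolding h by simp
qed

end

section \<open>Direct sums of projective submodules\<close>

lemma right_module_hom_zero:
  assumes A: "right_module R A" and B: "right_module R B" and f: "f \<in> right_module_hom R A B"
  shows "f \<zero>\<^bsub>A\<^esub> = \<zero>\<^bsub>B\<^esub>"
proof -
  interpret A: right_module R A by (rule A)
  interpret B: right_module R B by (rule B)
  have "f (\<zero>\<^bsub>R\<^esub> \<odot>\<^bsub>A\<^esub> \<zero>\<^bsub>A\<^esub>) = \<zero>\<^bsub>R\<^esub> \<odot>\<^bsub>B\<^esub> f \<zero>\<^bsub>A\<^esub>" and "f \<zero>\<^bsub>A\<^esub> \<in> carrier B"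
    using f by (auto simp: right_module_hom_def hom_def simp del: A.smult_scalar_zero A.smult_vector_zero)
  then show ?thesis by simp
qed

context right_module
begin

lemma projective_zero: "projective_module R (M\<lparr>carrier := {\<zero>\<^bsub>M\<^esub>}\<rparr>)"
  unfolding projective_module_def has_lifting_def
proof (intro conjI allI impI ballI)
  show "right_module R (M\<lparr>carrier := {\<zero>\<^bsub>M\<^esub>}\<rparr>)"
    by (rule right_module_submodule[OF submodule_zero])
next
  fix A :: "('a, 'c \<Rightarrow> 'a) module" and B :: "('a, 'c) module" and g f
  assume "right_module R A \<and> right_module R B"
  then interpret A: right_module R A + B: right_module R B by auto
  assume g: "g \<in> right_module_hom R A B"
    and f: "f \<in> right_module_hom R (M\<lparr>carrier := {\<zero>\<^bsub>M\<^esub>}\<rparr>) B"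
  have g0: "g \<zero>\<^bsub>A\<^esub> = \<zero>\<^bsub>B\<^esub>"
    by (rule right_module_hom_zero[OF A.right_module_axioms B.right_module_axioms g])
  have f0: "f \<zero>\<^bsub>M\<^esub> = \<zero>\<^bsub>B\<^esub>"
    using right_module_hom_zero[OF right_module_submodule[OF submodule_zero] B.right_module_axioms f]
    by simp
  show "\<exists>h\<in>right_module_hom R (M\<lparr>carrier := {\<zero>\<^bsub>M\<^esub>}\<rparr>) A.
          \<forall>x\<in>carrier (M\<lparr>carrier := {\<zero>\<^bsub>M\<^esub>}\<rparr>). g (h x) = f x"
    by (intro bexI[of _ "\<lambda>_. \<zero>\<^bsub>A\<^esub>"]) (auto simp: g0 f0 right_module_hom_def hom_def)
qed

text \<open>
  Lift the restrictions of a map to the two summands separately and add the lifts; this is well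
  defined because the two components of an element of the sum are unique.
\<close>

lemma projective_set_add:
  assumes H: "submodule H R M" "projective_module R (M\<lparr>carrier := H\<rparr>)"
    and K: "submodule K R M" "projective_module R (M\<lparr>carrier := K\<rparr>)"
    and disj: "H \<inter> K = {\<zero>\<^bsub>M\<^esub>}"
  shows "projective_module R (M\<lparr>carrier := H <+>\<^bsub>M\<^esub> K\<rparr>)"
  unfolding projective_module_def has_lifting_def
proof (intro conjI allI impI ballI)
  let ?S = "M\<lparr>carrier := H <+>\<^bsub>M\<^esub> K\<rparr>"
  note S = submodule_set_add[OF H(1) K(1)]
  show "right_module R ?S"
    by (rule right_module_submodule[OF S(1)])
  have Hc: "H \<subseteq> carrier M" "\<And>x y. x \<in> H \<Longrightarrow> y \<in> H \<Longrightarrow> x \<oplus>\<^bsub>M\<^esub> y \<in> H"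
    "\<And>a x. a \<in> carrier R \<Longrightarrow> x \<in> H \<Longrightarrow> a \<odot>\<^bsub>M\<^esub> x \<in> H"
    using H(1) unfolding submodule_iff by auto
  have Kc: "K \<subseteq> carrier M" "\<And>x y. x \<in> K \<Longrightarrow> y \<in> K \<Longrightarrow> x \<oplus>\<^bsub>M\<^esub> y \<in> K"
    "\<And>a x. a \<in> carrier R \<Longrightarrow> x \<in> K \<Longrightarrow> a \<odot>\<^bsub>M\<^esub> x \<in> K"
    using K(1) unfolding submodule_iff by auto
  fix A :: "('a, 'c \<Rightarrow> 'a) module" and B :: "('a, 'c) module" and g f
  assume AB: "right_module R A \<and> right_module R B"
  then interpret A: right_module R A + B: right_module R B by auto
  assume g: "g \<in> right_module_hom R A B" and f: "f \<in> right_module_hom R ?S B"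
    and surj: "g ` carrier A = carrier B"
  have fH: "f \<in> right_module_hom R (M\<lparr>carrier := H\<rparr>) B"
    and fK: "f \<in> right_module_hom R (M\<lparr>carrier := K\<rparr>) B"
    using f S(2,3) by (auto simp: right_module_hom_def hom_def Pi_iff subset_iff)
  have lift: "has_lifting R (M\<lparr>carrier := H\<rparr>) A B" "has_lifting R (M\<lparr>carrier := K\<rparr>) A B"
    using projective_has_lifting[OF H(2)] projective_has_lifting[OF K(2)]
      A.right_module_axioms B.right_module_axioms by blast+
  obtain h where h: "h \<in> right_module_hom R (M\<lparr>carrier := H\<rparr>) A" "\<And>x. x \<in> H \<Longrightarrow> g (h x) = f x"
    using lift(1)[unfolded has_lifting_def, rule_format, OF g fH surj] by auto
  obtain k where k: "k \<in> right_module_hom R (M\<lparr>carrier := K\<rparr>) A" "\<And>x. x \<in> K \<Longrightarrow> g (k x) = f x"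
    using lift(2)[unfolded has_lifting_def, rule_format, OF g fK surj] by auto
  have hh: "\<And>x. x \<in> H \<Longrightarrow> h x \<in> carrier A"
    "\<And>x y. x \<in> H \<Longrightarrow> y \<in> H \<Longrightarrow> h (x \<oplus>\<^bsub>M\<^esub> y) = h x \<oplus>\<^bsub>A\<^esub> h y"
    "\<And>a x. a \<in> carrier R \<Longrightarrow> x \<in> H \<Longrightarrow> h (a \<odot>\<^bsub>M\<^esub> x) = a \<odot>\<^bsub>A\<^esub> h x"
    using h(1) by (auto simp: right_module_hom_def hom_def)
  have kk: "\<And>x. x \<in> K \<Longrightarrow> k x \<in> carrier A"
    "\<And>x y. x \<in> K \<Longrightarrow> y \<in> K \<Longrightarrow> k (x \<oplus>\<^bsub>M\<^esub> y) = k x \<oplus>\<^bsub>A\<^esub> k y"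
    "\<And>a x. a \<in> carrier R \<Longrightarrow> x \<in> K \<Longrightarrow> k (a \<odot>\<^bsub>M\<^esub> x) = a \<odot>\<^bsub>A\<^esub> k x"
    using k(1) by (auto simp: right_module_hom_def hom_def)
  define l where "l x = (THE y. \<exists>u\<in>H. \<exists>v\<in>K. x = u \<oplus>\<^bsub>M\<^esub> v \<and> y = h u \<oplus>\<^bsub>A\<^esub> k v)" for x
  have l: "l (u \<oplus>\<^bsub>M\<^esub> v) = h u \<oplus>\<^bsub>A\<^esub> k v" if "u \<in> H" "v \<in> K" for u v
    unfolding l_def
    using that add_unique_if_disjoint[OF H(1) K(1) disj] by (intro the_equality) blast+
  have "l x \<in> carrier A" if "x \<in> H <+>\<^bsub>M\<^esub> K" for x
    using that l hh(1) kk(1) by (auto simp: mem_set_add_iff)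
  moreover have "l (x \<oplus>\<^bsub>M\<^esub> y) = l x \<oplus>\<^bsub>A\<^esub> l y" if xy: "x \<in> H <+>\<^bsub>M\<^esub> K" "y \<in> H <+>\<^bsub>M\<^esub> K" for x y
  proof -
    obtain u v u' v' where e: "u \<in> H" "v \<in> K" "u' \<in> H" "v' \<in> K"
      "x = u \<oplus>\<^bsub>M\<^esub> v" "y = u' \<oplus>\<^bsub>M\<^esub> v'"
      using xy unfolding mem_set_add_iff by blast
    then have "x \<oplus>\<^bsub>M\<^esub> y = (u \<oplus>\<^bsub>M\<^esub> u') \<oplus>\<^bsub>M\<^esub> (v \<oplus>\<^bsub>M\<^esub> v')"
      using Hc Kc by (simp add: subset_iff M.a_ac)
    then have "l (x \<oplus>\<^bsub>M\<^esub> y) = (h u \<oplus>\<^bsub>A\<^esub> h u') \<oplus>\<^bsub>A\<^esub> (k v \<oplus>\<^bsub>A\<^esub> k v')"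
      using e Hc Kc hh kk by (simp add: l)
    also have "\<dots> = l x \<oplus>\<^bsub>A\<^esub> l y"
      using e hh(1) kk(1) by (simp add: l A.M.a_ac)
    finally show ?thesis .
  qed
  moreover have "l (a \<odot>\<^bsub>M\<^esub> x) = a \<odot>\<^bsub>A\<^esub> l x" if a: "a \<in> carrier R" and x: "x \<in> H <+>\<^bsub>M\<^esub> K" for a x
  proof -
    obtain u v where e: "u \<in> H" "v \<in> K" "x = u \<oplus>\<^bsub>M\<^esub> v"
      using x unfolding mem_set_add_iff by blast
    then have "a \<odot>\<^bsub>M\<^esub> x = a \<odot>\<^bsub>M\<^esub> u \<oplus>\<^bsub>M\<^esub> a \<odot>\<^bsub>M\<^esub> v"
      using Hc Kc a by (simp add: subset_iff smult_distr_vector)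
    then show ?thesis
      using e Hc Kc hh kk a by (simp add: l A.smult_distr_vector)
  qed
  ultimately have "l \<in> right_module_hom R ?S A"
    by (auto simp: right_module_hom_def hom_def)
  moreover have "g (l x) = f x" if x: "x \<in> H <+>\<^bsub>M\<^esub> K" for x
  proof -
    obtain u v where e: "u \<in> H" "v \<in> K" "x = u \<oplus>\<^bsub>M\<^esub> v"
      using x unfolding mem_set_add_iff by blast
    then have "g (l x) = g (h u) \<oplus>\<^bsub>B\<^esub> g (k v)"
      using g hh(1) kk(1) by (simp add: l right_module_hom_def hom_def)
    also have "\<dots> = f x"
      using e S(2,3) f h(2) k(2) by (auto simp: right_module_hom_def hom_def subset_iff)
    finally show ?thesis .
  qed
  ultimately show "\<exists>h\<in>right_module_hom R ?S A. \<forall>x\<in>carrier ?S. g (h x) = f x"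
    by auto
qed

end

section \<open>Splitting off projective summands\<close>

definition projective_splitting ::
    "('r, 's) ring_scheme \<Rightarrow> ('r, 'a, 'm) module_scheme \<Rightarrow> 'a set \<Rightarrow> 'a set \<Rightarrow> bool" where
  "projective_splitting R M P N \<longleftrightarrow>
     internal_direct_sum R M P N \<and> projective_module R (M\<lparr>carrier := P\<rparr>)"

context right_module
begin

lemma projective_splitting_trivial: "projective_splitting R M {\<zero>\<^bsub>M\<^esub>} (carrier M)"
  unfolding projective_splitting_def internal_direct_sum_def
  using submodule_zero submodule_carrier projective_zero
    submodule_set_add[OF submodule_zero submodule_carrier]
  by (auto simp: submodule_iff)

text \<open>
  Direct sums are associative, \<open>P \<oplus> (P' \<oplus> N') = (P \<oplus> P') \<oplus> N'\<close>. The second conclusion says that the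
  inner sum on the right is direct as well, which is what projectivity of \<open>P + P'\<close> needs.
\<close>

lemma internal_direct_sum_assoc:
  assumes PN: "internal_direct_sum R M P N"
    and PN': "internal_direct_sum R (M\<lparr>carrier := N\<rparr>) P' N'"
  shows "internal_direct_sum R M (P <+>\<^bsub>M\<^esub> P') N'" "P \<inter> P' = {\<zero>\<^bsub>M\<^esub>}"
proof -
  have P: "submodule P R M" and N: "submodule N R M"
    and sum: "P <+>\<^bsub>M\<^esub> N = carrier M" and disj: "P \<inter> N = {\<zero>\<^bsub>M\<^esub>}"
    using PN by (auto simp: internal_direct_sum_def)
  have P': "submodule P' R M" "P' \<subseteq> N" and N': "submodule N' R M" "N' \<subseteq> N"
    and sum': "P' <+>\<^bsub>M\<^esub> N' = N" and disj': "P' \<inter> N' = {\<zero>\<^bsub>M\<^esub>}"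
    using PN' by (auto simp: internal_direct_sum_def submodule_of_submodule_iff[OF N] set_add_defs)
  have zero: "\<zero>\<^bsub>M\<^esub> \<in> P" "\<zero>\<^bsub>M\<^esub> \<in> P'" "\<zero>\<^bsub>M\<^esub> \<in> N'" "\<zero>\<^bsub>M\<^esub> \<in> N"
    and sub: "P \<subseteq> carrier M" "P' \<subseteq> carrier M" "N' \<subseteq> carrier M"
    using P P' N' N by (auto simp: submodule_iff)
  show "P \<inter> P' = {\<zero>\<^bsub>M\<^esub>}"
    using disj P'(2) zero by auto
  note S = submodule_set_add[OF P P'(1)]
  have "carrier M \<subseteq> (P <+>\<^bsub>M\<^esub> P') <+>\<^bsub>M\<^esub> N'"
  proof
    fix x assume "x \<in> carrier M"
    then obtain p y where p: "p \<in> P" "y \<in> N" "x = p \<oplus>\<^bsub>M\<^esub> y"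
      unfolding sum[symmetric] mem_set_add_iff by blast
    then obtain q n where q: "q \<in> P'" "n \<in> N'" "y = q \<oplus>\<^bsub>M\<^esub> n"
      unfolding sum'[symmetric] mem_set_add_iff by blast
    note e = p(1) q(1,2) p(3)[unfolded q(3)]
    then have "x = (p \<oplus>\<^bsub>M\<^esub> q) \<oplus>\<^bsub>M\<^esub> n"
      using sub by (simp add: subset_iff M.a_assoc)
    moreover have "p \<oplus>\<^bsub>M\<^esub> q \<in> P <+>\<^bsub>M\<^esub> P'"
      using e unfolding mem_set_add_iff by blast
    ultimately show "x \<in> (P <+>\<^bsub>M\<^esub> P') <+>\<^bsub>M\<^esub> N'"
      using e(3) by (subst mem_set_add_iff) blast
  qed
  moreover have "(P <+>\<^bsub>M\<^esub> P') <+>\<^bsub>M\<^esub> N' \<subseteq> carrier M"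
    using submodule_set_add(1)[OF S(1) N'(1)] by (auto simp: submodule_iff)
  moreover have "x = \<zero>\<^bsub>M\<^esub>" if "x \<in> P <+>\<^bsub>M\<^esub> P'" "x \<in> N'" for x
  proof -
    obtain p q where e: "p \<in> P" "q \<in> P'" "x = p \<oplus>\<^bsub>M\<^esub> q"
      using \<open>x \<in> P <+>\<^bsub>M\<^esub> P'\<close> unfolding mem_set_add_iff by blast
    have "p \<oplus>\<^bsub>M\<^esub> q = \<zero>\<^bsub>M\<^esub> \<oplus>\<^bsub>M\<^esub> x"
      using e(3) that(2) sub by (simp add: subset_iff)
    moreover have "q \<in> N" "x \<in> N"
      using e(2) that(2) P'(2) N'(2) by auto
    ultimately have "q = x"
      using add_unique_if_disjoint(2)[OF P N disj e(1) zero(1)] by blast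
    then show ?thesis using disj' e(2) that(2) by auto
  qed
  ultimately show "internal_direct_sum R M (P <+>\<^bsub>M\<^esub> P') N'"
    unfolding internal_direct_sum_def using S N' zero by auto
qed

lemma projective_splitting_refine:
  assumes PN: "projective_splitting R M P N"
    and unstable: "\<not> stable_module R (M\<lparr>carrier := N\<rparr>)"
  shows "\<exists>P' N'. projective_splitting R M P' N' \<and> P \<subset> P' \<and> N' \<subset> N"
proof -
  have P: "submodule P R M" and N: "submodule N R M"
    and disj: "P \<inter> N = {\<zero>\<^bsub>M\<^esub>}" and ds: "internal_direct_sum R M P N"
    and proj: "projective_module R (M\<lparr>carrier := P\<rparr>)"
    using PN by (auto simp: projective_splitting_def internal_direct_sum_def)
  obtain Q N' where QN: "internal_direct_sum R (M\<lparr>carrier := N\<rparr>) Q N'"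
    and projQ: "projective_module R (M\<lparr>carrier := Q\<rparr>)" and nz: "Q \<noteq> {\<zero>\<^bsub>M\<^esub>}"
    using unstable by (auto simp: stable_module_def)
  have Q: "submodule Q R M" "Q \<subseteq> N" and N': "N' \<subseteq> N" and disj': "Q \<inter> N' = {\<zero>\<^bsub>M\<^esub>}"
    using QN by (auto simp: internal_direct_sum_def submodule_of_submodule_iff[OF N])
  have "\<zero>\<^bsub>M\<^esub> \<in> Q"
    using Q(1) by (simp add: submodule_iff)
  with nz obtain q where q: "q \<in> Q" "q \<noteq> \<zero>\<^bsub>M\<^esub>" by auto
  note S = submodule_set_add[OF P Q(1)]
  have "projective_splitting R M (P <+>\<^bsub>M\<^esub> Q) N'"
    unfolding projective_splitting_def
    using internal_direct_sum_assoc[OF ds QN] projective_set_add[OF P proj Q(1) projQ] by blast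
  moreover have "P \<subset> P <+>\<^bsub>M\<^esub> Q"
    using S(2,3) q Q(2) disj by blast
  moreover have "N' \<subset> N"
    using N' q Q(2) disj' by blast
  ultimately show ?thesis by blast
qed

lemma stable_complement_exists:
  assumes "noetherian_module R M \<or> artinian_module R M"
  shows "\<exists>P N. projective_splitting R M P N \<and> stable_module R (M\<lparr>carrier := N\<rparr>)"
proof (rule ccontr)
  assume unstable: "\<not> ?thesis"
  have "\<exists>D. \<forall>n. projective_splitting R M (fst (D n)) (snd (D n)) \<and>
          (fst (D n) \<subset> fst (D (Suc n)) \<and> snd (D (Suc n)) \<subset> snd (D n))"
  proof (rule dependent_nat_choice)
    show "\<exists>D. projective_splitting R M (fst D) (snd D)"
      using projective_splitting_trivial by auto
  next
    fix D and n :: nat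
    assume "projective_splitting R M (fst D) (snd D)"
    then show "\<exists>E. projective_splitting R M (fst E) (snd E) \<and> (fst D \<subset> fst E \<and> snd E \<subset> snd D)"
      using projective_splitting_refine[of "fst D" "snd D"] unstable by auto
  qed
  then obtain D where "\<forall>n. projective_splitting R M (fst (D n)) (snd (D n)) \<and>
      (fst (D n) \<subset> fst (D (Suc n)) \<and> snd (D (Suc n)) \<subset> snd (D n))"
    by (rule exE)
  then have D: "projective_splitting R M (fst (D n)) (snd (D n))"
    "fst (D n) \<subset> fst (D (Suc n))" "snd (D (Suc n)) \<subset> snd (D n)" for n
    by simp_all
  have sub: "submodule (fst (D n)) R M" "submodule (snd (D n)) R M" for n
    using D(1)[of n] by (auto simp: projective_splitting_def internal_direct_sum_def)
  from assms show False
  proof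
    assume "noetherian_module R M"
    then obtain n where "\<forall>m\<ge>n. fst (D m) = fst (D n)"
      using sub(1) D(2) unfolding noetherian_module_def by (meson psubset_imp_subset)
    then show False
      using D(2)[of n] by (metis le_SucI order_refl psubsetE)
  next
    assume "artinian_module R M"
    then obtain n where "\<forall>m\<ge>n. snd (D m) = snd (D n)"
      using sub(2) D(3) unfolding artinian_module_def by (meson psubset_imp_subset)
    then show False
      using D(3)[of n] by (metis le_SucI order_refl psubsetE)
  qed
qed

end

section \<open>Finitely generated modules over right Noetherian rings\<close>

lemma (in ring) regular_right_module_is_right_module: "right_module R (regular_right_module R)"
proof -
  have "abelian_group (regular_right_module R)"
  proof (rule abelian_groupI)
    show "\<exists>y\<in>carrier (regular_right_module R).
            y \<oplus>\<^bsub>regular_right_module R\<^esub> x = \<zero>\<^bsub>regular_right_module R\<^esub>"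
      if "x \<in> carrier (regular_right_module R)" for x
      using that by (intro bexI[of _ "\<ominus> x"]) (auto simp: regular_right_module_def l_neg)
  qed (auto simp: regular_right_module_def a_ac)
  then show ?thesis
    by (intro right_module.intro right_module_axioms.intro ring_axioms)
      (auto simp: regular_right_module_def l_distr r_distr m_assoc)
qed

context right_module
begin

lemma noetherian_zero: "noetherian_module R (M\<lparr>carrier := {\<zero>\<^bsub>M\<^esub>}\<rparr>)"
proof -
  have "H = {\<zero>\<^bsub>M\<^esub>}" if "submodule H R (M\<lparr>carrier := {\<zero>\<^bsub>M\<^esub>}\<rparr>)" for H
    using that unfolding submodule_of_submodule_iff[OF submodule_zero] by (auto simp: submodule_iff)
  then show ?thesis
    unfolding noetherian_module_def by metis
qed

lemma minus_solve:
  assumes "x = y \<oplus>\<^bsub>M\<^esub> z" "y \<in> carrier M" "z \<in> carrier M"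
  shows "z = x \<oplus>\<^bsub>M\<^esub> \<ominus>\<^bsub>M\<^esub> y"
proof -
  have "x \<oplus>\<^bsub>M\<^esub> \<ominus>\<^bsub>M\<^esub> y = z \<oplus>\<^bsub>M\<^esub> (y \<oplus>\<^bsub>M\<^esub> \<ominus>\<^bsub>M\<^esub> y)"
    unfolding assms(1) using assms(2,3) by (simp add: M.a_ac)
  then show ?thesis
    using assms(2,3) by (simp add: M.r_neg)
qed

lemma submodule_transporter:
  assumes "submodule L R M" "s \<in> carrier M"
  shows "submodule {a \<in> carrier R. a \<odot>\<^bsub>M\<^esub> s \<in> L} R (regular_right_module R)"
  unfolding right_module.submodule_iff[OF R.regular_right_module_is_right_module]
  using assms
  by (auto simp: submodule_iff regular_right_module_def smult_distr_scalar smult_assoc)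

text \<open>
  For \<open>H \<subseteq> H'\<close> inside \<open>K + sR\<close>, equality follows from equality of the intersections with \<open>K\<close> and
  of the right ideals \<open>{a. s a \<in> H + K}\<close>: an element of \<open>H'\<close> has the same \<open>s\<close>-part as some element
  of \<open>H\<close>, and their difference lies in \<open>H' \<inter> K = H \<inter> K\<close>. In an ascending chain both invariants
  eventually become constant.
\<close>

lemma noetherian_add_cyclic:
  assumes R: "right_noetherian_ring R" and K: "submodule K R M"
    and noeth: "noetherian_module R (M\<lparr>carrier := K\<rparr>)" and s: "s \<in> carrier M"
  shows "noetherian_module R (M\<lparr>carrier := K <+>\<^bsub>M\<^esub> (\<lambda>a. a \<odot>\<^bsub>M\<^esub> s) ` carrier R\<rparr>)"
  unfolding noetherian_module_def
proof (intro allI impI)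
  let ?S = "K <+>\<^bsub>M\<^esub> (\<lambda>a. a \<odot>\<^bsub>M\<^esub> s) ` carrier R"
  have S: "submodule ?S R M"
    by (rule submodule_set_add(1)[OF K submodule_cyclic[OF s]])
  fix H :: "nat \<Rightarrow> 'c set"
  assume "(\<forall>n. submodule (H n) R (M\<lparr>carrier := ?S\<rparr>)) \<and> (\<forall>n. H n \<subseteq> H (Suc n))"
  then have H: "\<And>n. submodule (H n) R M" "\<And>n. H n \<subseteq> ?S" and asc: "\<And>n. H n \<subseteq> H (Suc n)"
    by (auto simp: submodule_of_submodule_iff[OF S])
  define I where "I n = {a \<in> carrier R. a \<odot>\<^bsub>M\<^esub> s \<in> H n <+>\<^bsub>M\<^esub> K}" for n
  have "submodule (I n) R (regular_right_module R)" for n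
    unfolding I_def by (rule submodule_transporter[OF submodule_set_add(1)[OF H(1) K] s])
  moreover have "I n \<subseteq> I (Suc n)" for n
    using asc[of n] by (auto simp: I_def mem_set_add_iff)
  ultimately obtain n1 where n1: "\<And>m. m \<ge> n1 \<Longrightarrow> I m = I n1"
    using R unfolding right_noetherian_ring_def noetherian_module_def by meson
  have "submodule (H n \<inter> K) R (M\<lparr>carrier := K\<rparr>)" for n
    using submodule_inter[OF H(1) K] by (simp add: submodule_of_submodule_iff[OF K])
  moreover have "H n \<inter> K \<subseteq> H (Suc n) \<inter> K" for n
    using asc[of n] by auto
  ultimately have "\<exists>n. \<forall>m\<ge>n. H m \<inter> K = H n \<inter> K"
    using noeth[unfolded noetherian_module_def, rule_format, of "\<lambda>n. H n \<inter> K"] by simp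
  then obtain n2 where n2: "\<And>m. m \<ge> n2 \<Longrightarrow> H m \<inter> K = H n2 \<inter> K"
    by blast
  define n where "n = max n1 n2"
  have "H m = H n" if m: "m \<ge> n" for m
  proof
    show sub: "H n \<subseteq> H m"
      using lift_Suc_mono_le[of H n m] asc m by simp
    show "H m \<subseteq> H n"
    proof
      fix x assume x: "x \<in> H m"
      then obtain k a where ka: "k \<in> K" "a \<in> carrier R" "x = k \<oplus>\<^bsub>M\<^esub> a \<odot>\<^bsub>M\<^esub> s"
        using H(2)[of m] by (auto simp: mem_set_add_iff subset_iff)
      have c: "k \<in> carrier M" "x \<in> carrier M" "a \<odot>\<^bsub>M\<^esub> s \<in> carrier M"
        using ka K x H(1)[of m] s by (auto simp: submodule_iff)
      have "a \<odot>\<^bsub>M\<^esub> s = x \<oplus>\<^bsub>M\<^esub> \<ominus>\<^bsub>M\<^esub> k"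
        using minus_solve[OF ka(3)] c by simp
      then have "a \<in> I m"
        using ka x submodule_minus_closed[OF K ka(1)] unfolding I_def mem_set_add_iff by blast
      then have "a \<in> I n"
        using n1[of m] n1[of n] m by (simp add: n_def)
      then obtain y k' where y: "y \<in> H n" "k' \<in> K" "a \<odot>\<^bsub>M\<^esub> s = y \<oplus>\<^bsub>M\<^esub> k'"
        unfolding I_def mem_set_add_iff by blast
      have c': "y \<in> carrier M" "k' \<in> carrier M"
        using y H(1)[of n] K by (auto simp: submodule_iff)
      have xy: "x = y \<oplus>\<^bsub>M\<^esub> (k \<oplus>\<^bsub>M\<^esub> k')"
        using ka(3) y(3) c c' by (simp add: M.a_ac)
      have "k \<oplus>\<^bsub>M\<^esub> k' = x \<oplus>\<^bsub>M\<^esub> \<ominus>\<^bsub>M\<^esub> y"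
        using minus_solve[OF xy] c c' by simp
      moreover have "x \<oplus>\<^bsub>M\<^esub> \<ominus>\<^bsub>M\<^esub> y \<in> H m"
        using x y sub submodule_minus_closed[OF H(1)[of m], of y] H(1)[of m]
        by (auto simp: submodule_iff)
      moreover have "k \<oplus>\<^bsub>M\<^esub> k' \<in> K"
        using ka y K by (auto simp: submodule_iff)
      ultimately have "k \<oplus>\<^bsub>M\<^esub> k' \<in> H m \<inter> K"
        by simp
      then have "k \<oplus>\<^bsub>M\<^esub> k' \<in> H n"
        using n2[of m] n2[of n] m by (auto simp: n_def)
      then show "x \<in> H n"
        unfolding xy using y H(1)[of n] by (auto simp: submodule_iff)
    qed
  qed
  then show "\<exists>n. \<forall>m\<ge>n. H m = H n" by blast
qed

text \<open>
  The induction over the generators only keeps track of some Noetherian submodule containing them;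
  once it contains all of them, it is the whole module.
\<close>

lemma noetherian_if_finitely_generated:
  assumes R: "right_noetherian_ring R" and fg: "finitely_generated_module R M"
  shows "noetherian_module R M"
proof -
  obtain S where S: "finite S" "S \<subseteq> carrier M" "\<Inter>{H. submodule H R M \<and> S \<subseteq> H} = carrier M"
    using fg by (auto simp: finitely_generated_module_def)
  from S(1,2) have "\<exists>K. submodule K R M \<and> S \<subseteq> K \<and> noetherian_module R (M\<lparr>carrier := K\<rparr>)"
  proof (induction S rule: finite_induct)
    case empty
    then show ?case using submodule_zero noetherian_zero by blast
  next
    case (insert s S)
    then obtain K where K: "submodule K R M" "S \<subseteq> K" "noetherian_module R (M\<lparr>carrier := K\<rparr>)"
      and s: "s \<in> carrier M"
      by auto
    note sum = submodule_set_add[OF K(1) submodule_cyclic[OF s]]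
    have "s \<in> (\<lambda>a. a \<odot>\<^bsub>M\<^esub> s) ` carrier R"
      using s by (intro image_eqI[of _ _ "\<one>\<^bsub>R\<^esub>"]) auto
    then show ?case
      using sum K(2) noetherian_add_cyclic[OF R K(1,3) s] by blast
  qed
  then obtain K where K: "submodule K R M" "S \<subseteq> K" "noetherian_module R (M\<lparr>carrier := K\<rparr>)"
    by blast
  then have "K = carrier M"
    using S(3) by (auto simp: submodule_iff)
  then show ?thesis using K(3) by simp
qed

end

theorem corollary2p3:
  fixes R :: "('r, 's) ring_scheme" and M :: "('r, 'a, 'm) module_scheme"
  assumes "ring R" and "right_module R M"
  shows "(noetherian_module R M \<or> artinian_module R M \<longrightarrow>
            (\<exists>P N. internal_direct_sum R M P N \<and>
               projective_module R (M\<lparr>carrier := P\<rparr>) \<and> stable_module R (M\<lparr>carrier := N\<rparr>))) \<and>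
         (right_noetherian_ring R \<and> finitely_generated_module R M \<longrightarrow>
            (\<exists>P N. internal_direct_sum R M P N \<and>
               projective_module R (M\<lparr>carrier := P\<rparr>) \<and> stable_module R (M\<lparr>carrier := N\<rparr>)))"
  using right_module.stable_complement_exists[OF assms(2)]
    right_module.noetherian_if_finitely_generated[OF assms(2)]
  unfolding projective_splitting_def by blast

end
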